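(* For every non-zero real scalar $\alpha$, $$(\delta)\int_{R^{\infty}}\delta(\alpha x)\,d\lambda(x)=|\alpha|^{-\infty},$$ where the left-hand side means $\lim_{\epsilon\to 0+}\int_{R^{\infty}}\eta_{\epsilon}(\alpha x)\,d\lambda(x)$ (with values in $[0,+\infty]$), and $|\alpha|^{-\infty}$ equals $0$ if $|\alpha|>1$, equals $1$ if $|\alpha|=1$, and equals $+\infty$ if $|\alpha|<1$.
   Context: $R$ denotes the real line. $R^{\infty}=\prod_{k=1}^{\infty}R$ is the space of all real sequences with the Tychonoff (product) topology. $\lambda$ denotes a Baker measure on $R^{\infty}$: the completion of a translation-invariant Borel measure on $R^{\infty}$ such that $\lambda\big(\prod_{i=1}^{\infty}(a_i,b_i)\big)=\prod_{i=1}^{\infty}(b_i-a_i):=\lim_{n\to\infty}\prod_{i=1}^{n}(b_i-a_i)$ whenever $-\infty<a_i<b_i<+\infty$ for all $i$ and $0\le\prod_{i=1}^{\infty}(b_i-a_i)<+\infty$. For $\epsilon>0$ put $a_k(\epsilon)=\frac12 e^{-\frac{1}{2^k\epsilon}}$ for $k\ge 1$, and $\Delta_{\epsilon}=\prod_{k=1}^{\infty}[-a_k(\epsilon),a_k(\epsilon)]$. Its measure is $\lambda(\Delta_{\epsilon})=\prod_{k=1}^{\infty}2a_k(\epsilon)=e^{-\sum_{k=1}^{\infty}\frac{1}{2^k\epsilon}}$. Define $\eta_{\epsilon}:R^{\infty}\to R$ by $\eta_{\epsilon}(x)=e^{\sum_{k=1}^{\infty}\frac{1}{2^k\epsilon}}$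 if $x\in\Delta_{\epsilon}$ and $\eta_{\epsilon}(x)=0$ otherwise. *)

theory Defs
  imports "HOL-Analysis.Analysis"
begin

text \<open>The space of all real sequences is the type \<open>nat \<Rightarrow> real\<close>, whose topology
  is the product topology, so \<open>borel\<close> on it is the Borel sigma-algebra of that topology.
  Coordinates are counted from \<open>0\<close>: the coordinate \<open>x i\<close> is the \<open>(i + 1)\<close>-st one.\<close>

definition translation_invariant :: "(nat \<Rightarrow> real) measure \<Rightarrow> bool" where
  "translation_invariant M \<longleftrightarrow>
    (\<forall>v. \<forall>A \<in> sets M. emeasure M ((\<lambda>x i. x i + v i) ` A) = emeasure M A)"

text \<open>The condition on boxes only concerns boxes whose partial products of side lengths
  converge to a finite limit \<open>p\<close>, where \<open>p = 0\<close> is allowed. This differs from convergence in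
  the sense of infinite products (\<open>convergent_prod\<close>), which excludes products tending to \<open>0\<close>.\<close>

definition baker_measure :: "(nat \<Rightarrow> real) measure \<Rightarrow> bool" where
  "baker_measure L \<longleftrightarrow>
    (\<exists>M. sets M = sets borel \<and> translation_invariant M \<and>
      (\<forall>a b p. (\<forall>i. a i < b i) \<longrightarrow> (\<lambda>n. \<Prod>i<n. b i - a i) \<longlonglongrightarrow> p \<longrightarrow>
        emeasure M {x. \<forall>i. x i \<in> {a i<..<b i}} = ennreal p) \<and>
      L = completion M)"

definition half_side :: "real \<Rightarrow> nat \<Rightarrow> real" where
  "half_side \<epsilon> k = 1 / 2 * exp (- (1 / (2 ^ k * \<epsilon>)))"

definition Delta_box :: "real \<Rightarrow> (nat \<Rightarrow> real) set" where
  "Delta_box \<epsilon> = {x. \<forall>i. x i \<in> {- half_side \<epsilon> (Suc i)..half_side \<epsilon> (Suc i)}}"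

definition eta :: "real \<Rightarrow> (nat \<Rightarrow> real) \<Rightarrow> real" where
  "eta \<epsilon> x = (if x \<in> Delta_box \<epsilon> then exp (\<Sum>i. 1 / (2 ^ Suc i * \<epsilon>)) else 0)"

definition abs_pow_minus_infinity :: "real \<Rightarrow> ennreal" where
  "abs_pow_minus_infinity \<alpha> = (if \<bar>\<alpha>\<bar> > 1 then 0 else if \<bar>\<alpha>\<bar> = 1 then 1 else \<infinity>)"

end

theory Submission
  imports Defs
begin

text \<open>The scaled box \<open>{x. \<alpha> x \<in> Delta_box \<epsilon>}\<close> has sides \<open>2 a\<^sub>k / \<bar>\<alpha>\<bar>\<close>, so its partial volumes are
  \<open>exp (- (1 - 2\<^sup>-\<^sup>n) / \<epsilon>) / \<bar>\<alpha>\<bar>\<^sup>n\<close>, and multiplying their limit by the height \<open>exp (1 / \<epsilon>)\<close>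
  gives exactly \<open>\<bar>\<alpha>\<bar>\<^sup>-\<^sup>\<infinity>\<close> for every \<open>\<epsilon>\<close>. Closed boxes are squeezed between open ones by enlarging the \<open>i\<close>-th
  side by the factor \<open>exp (\<delta> / 2\<^sup>i)\<close>, which multiplies the volume by \<open>exp \<delta>\<close>.
  If \<open>\<bar>\<alpha>\<bar> < 1\<close> the partial volumes diverge, and one compares with the sub-boxes whose sides are
  scaled in the first \<open>N\<close> coordinates only.\<close>

lemma borel_measurable_coordinate [measurable]:
  "(\<lambda>x :: 'i \<Rightarrow> 'b :: topological_space. x i) \<in> borel_measurable borel"
  by (intro borel_measurable_continuous_onI continuous_on_product_coordinates)

lemma sets_borel_boxes:
  fixes a b :: "'i :: countable \<Rightarrow> real"
  shows "{x. \<forall>i. x i \<in> {a i..b i}} \<in> sets borel"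
    and "{x. \<forall>i. x i \<in> {a i<..<b i}} \<in> sets borel"
proof -
  have "{x \<in> space borel. \<forall>i. x i \<in> {a i..b i}} \<in> sets borel"
    by measurable
  then show "{x. \<forall>i. x i \<in> {a i..b i}} \<in> sets borel" by simp
  have "{x \<in> space borel. \<forall>i. x i \<in> {a i<..<b i}} \<in> sets borel"
    by measurable
  then show "{x. \<forall>i. x i \<in> {a i<..<b i}} \<in> sets borel" by simp
qed

text \<open>Serves twice: with \<open>c\<close> = \<delta> for the enlargement factors of a box, and
  with \<open>c\<close> = 1 / \<epsilon> for the exponent in \<open>eta\<close>.\<close>

lemma sums_dyadic: "(\<lambda>i. c / 2 ^ Suc i) sums (c :: real)"
  using sums_mult[OF power_half_series, of c] by (simp add: power_divide)

text \<open>Needed because the Baker condition speaks of open boxes while \<open>Delta_box\<close>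
  is closed. Enlarging the sides by factors, not by a fixed amount, keeps the partial volumes
  convergent, also for \<open>p = 0\<close>.\<close>

lemma emeasure_closed_box:
  fixes M :: "(nat \<Rightarrow> real) measure"
  assumes sets: "sets M = sets borel"
    and box: "\<And>a b p. (\<And>i. a i < b i) \<Longrightarrow> (\<lambda>n. \<Prod>i<n. b i - a i) \<longlonglongrightarrow> p \<Longrightarrow>
      emeasure M {x. \<forall>i. x i \<in> {a i<..<b i}} = ennreal p"
    and less: "\<And>i. a i < b i" and lim: "(\<lambda>n. \<Prod>i<n. b i - a i) \<longlonglongrightarrow> p"
  shows "emeasure M {x. \<forall>i. x i \<in> {a i..b i}} = ennreal p"
proof (rule antisym)
  let ?C = "{x. \<forall>i. x i \<in> {a i..b i}}"
  have "ennreal p = emeasure M {x. \<forall>i. x i \<in> {a i<..<b i}}"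
    using box[OF less lim] by simp
  also have "\<dots> \<le> emeasure M ?C"
    by (rule emeasure_mono) (auto simp: sets sets_borel_boxes less_imp_le)
  finally show "ennreal p \<le> emeasure M ?C" .
  have "emeasure M ?C \<le> ennreal (p * exp \<delta>)" if "\<delta> > 0" for \<delta>
  proof -
    \<comment> \<open>Half the growth of the \<open>i\<close>-th side, so that pushing out both ends
      multiplies its length by \<open>exp (\<delta> / 2 ^ Suc i)\<close>. With \<open>Suc i\<close>
      the exponents sum to exactly \<delta> from index 0 on.\<close>
    define e where "e i = (b i - a i) * (exp (\<delta> / 2 ^ Suc i) - 1) / 2" for i :: nat
    have e: "e i > 0" for i
      using less[of i] that by (simp add: e_def)
    have side: "(b i + e i) - (a i - e i) = (b i - a i) * exp (\<delta> / 2 ^ Suc i)" for i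
      by (simp add: e_def field_simps)
    have "(\<lambda>n. (\<Prod>i<n. b i - a i) * exp (\<Sum>i<n. \<delta> / 2 ^ Suc i)) \<longlonglongrightarrow> p * exp \<delta>"
      using sums_dyadic[of \<delta>] unfolding sums_def by (intro tendsto_intros lim)
    then have "(\<lambda>n. \<Prod>i<n. (b i + e i) - (a i - e i)) \<longlonglongrightarrow> p * exp \<delta>"
      unfolding side by (simp add: prod.distrib exp_sum)
    moreover have "a i - e i < b i + e i" for i
      using e[of i] less[of i] by simp
    ultimately have "emeasure M {x. \<forall>i. x i \<in> {a i - e i<..<b i + e i}} = ennreal (p * exp \<delta>)"
      by (intro box) auto
    moreover have "emeasure M ?C \<le> emeasure M {x. \<forall>i. x i \<in> {a i - e i<..<b i + e i}}"
    proof (rule emeasure_mono)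
      show "?C \<subseteq> {x. \<forall>i. x i \<in> {a i - e i<..<b i + e i}}"
      proof clarify
        fix x i
        assume "\<forall>i. x i \<in> {a i..b i}"
        then have "x i \<in> {a i..b i}" by blast
        then show "x i \<in> {a i - e i<..<b i + e i}"
          using e[of i] by simp
      qed
    qed (simp only: sets sets_borel_boxes)
    ultimately show ?thesis by simp
  qed
  then have "\<forall>\<^sub>F \<delta> in at_right 0. emeasure M ?C \<le> ennreal (p * exp \<delta>)"
    by (auto intro: eventually_mono[OF eventually_at_right_less])
  moreover have "((\<lambda>\<delta>. ennreal (p * exp \<delta>)) \<longlongrightarrow> ennreal (p * exp 0)) (at_right 0)"
    by (intro tendsto_intros)
  ultimately show "emeasure M ?C \<le> ennreal p"
    using tendsto_lowerbound[of "\<lambda>\<delta>. ennreal (p * exp \<delta>)"] by simp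
qed

theorem theorem5p2:
  fixes L :: "(nat \<Rightarrow> real) measure" and \<alpha> :: real
  assumes "baker_measure L" and "\<alpha> \<noteq> 0"
  shows "((\<lambda>\<epsilon>. \<integral>\<^sup>+ x. ennreal (eta \<epsilon> (\<lambda>i. \<alpha> * x i)) \<partial>L)
    \<longlongrightarrow> abs_pow_minus_infinity \<alpha>) (at_right 0)"
proof -
  obtain M where sets: "sets M = sets borel" and L: "L = completion M"
    and box: "\<And>a b p. (\<And>i. a i < b i) \<Longrightarrow> (\<lambda>n. \<Prod>i<n. b i - a i) \<longlonglongrightarrow> p \<Longrightarrow>
      emeasure M {x. \<forall>i. x i \<in> {a i<..<b i}} = ennreal p"
    using assms(1) unfolding baker_measure_def by auto
  have "(\<integral>\<^sup>+ x. ennreal (eta \<epsilon> (\<lambda>i. \<alpha> * x i)) \<partial>L) = abs_pow_minus_infinity \<alpha>"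
    if "\<epsilon> > 0" for \<epsilon>
  proof -
    define h where "h i = half_side \<epsilon> (Suc i)" for i
    have h: "h i > 0" "2 * h i = exp (- (1 / \<epsilon> / 2 ^ Suc i))" for i
      by (simp_all add: h_def half_side_def mult.commute)
    have dyadic: "(\<lambda>i. 1 / \<epsilon> / 2 ^ Suc i) sums (1 / \<epsilon>)"
      by (rule sums_dyadic)
    have prod_h: "(\<lambda>n. \<Prod>i<n. 2 * h i) \<longlonglongrightarrow> exp (- (1 / \<epsilon>))"
      using dyadic unfolding h sums_def exp_sum[OF finite_lessThan, symmetric] sum_negf
      by (intro tendsto_intros)
    \<comment> \<open>The divisors may vary with the coordinate: constant |\<alpha>| gives the
      preimage of \<open>Delta_box\<close>, and divisors that are eventually 1 give the sub-boxes
      for |\<alpha>| < 1.\<close>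
    define C where "C c = {x. \<forall>i :: nat. x i \<in> {- (h i / c i)..h i / c i}}" for c
    have C_sets: "C c \<in> sets M" for c
      unfolding C_def sets by (rule sets_borel_boxes)
    have C_emeasure: "emeasure M (C c) = ennreal p"
      if "\<And>i. c i > 0" "(\<lambda>n. (\<Prod>i<n. 2 * h i) / (\<Prod>i<n. c i)) \<longlonglongrightarrow> p" for c p
      unfolding C_def
    proof (rule emeasure_closed_box[OF sets box])
      show "- (h i / c i) < h i / c i" for i
        using h(1)[of i] that(1)[of i] by (meson divide_pos_pos less_trans neg_less_0_iff_less)
      show "(\<lambda>n. \<Prod>i<n. h i / c i - - (h i / c i)) \<longlonglongrightarrow> p"
        using that(2) by (simp add: prod_dividef[symmetric])
    qed
    \<comment> \<open>The intervals are symmetric about 0, so the sign of \<alpha> is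
      irrelevant.\<close>
    have "\<alpha> * t \<in> {- h i..h i} \<longleftrightarrow> t \<in> {- (h i / \<bar>\<alpha>\<bar>)..h i / \<bar>\<alpha>\<bar>}" for t i
      using assms(2) by (cases "\<alpha> > 0") (auto simp: field_simps)
    then have "(\<lambda>i. \<alpha> * x i) \<in> Delta_box \<epsilon> \<longleftrightarrow> x \<in> C (\<lambda>_. \<bar>\<alpha>\<bar>)" for x
      unfolding Delta_box_def C_def h_def by auto
    moreover have "(\<Sum>i. 1 / (2 ^ Suc i * \<epsilon>)) = 1 / \<epsilon>"
      using dyadic by (simp add: sums_iff mult.commute)
    ultimately have "(\<integral>\<^sup>+ x. ennreal (eta \<epsilon> (\<lambda>i. \<alpha> * x i)) \<partial>L)
        = (\<integral>\<^sup>+ x. ennreal (exp (1 / \<epsilon>)) * indicator (C (\<lambda>_. \<bar>\<alpha>\<bar>)) x \<partial>L)"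
      by (intro nn_integral_cong) (simp add: eta_def)
    \<comment> \<open>The box is Borel, so completing \<open>M\<close> does not change its
      measure.\<close>
    also have "\<dots> = ennreal (exp (1 / \<epsilon>)) * emeasure M (C (\<lambda>_. \<bar>\<alpha>\<bar>))"
      using C_sets by (simp add: L nn_integral_cmult_indicator)
    also have "\<dots> = abs_pow_minus_infinity \<alpha>"
    proof (cases "\<bar>\<alpha>\<bar>" "1 :: real" rule: linorder_cases)
      case greater
      \<comment> \<open>A convergent sequence times a null sequence: the Baker condition applies
        with limit 0 and makes the box null.\<close>
      have "(\<lambda>n. (\<Prod>i<n. 2 * h i) * (1 / \<bar>\<alpha>\<bar>) ^ n) \<longlonglongrightarrow> exp (- (1 / \<epsilon>)) * 0"
        using greater by (intro tendsto_mult prod_h LIMSEQ_realpow_zero) auto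
      then have "emeasure M (C (\<lambda>_. \<bar>\<alpha>\<bar>)) = ennreal 0"
        using greater by (intro C_emeasure) (auto simp: power_divide)
      then show ?thesis
        using greater by (simp add: abs_pow_minus_infinity_def)
    next
      case equal
      \<comment> \<open>The volume is the reciprocal of the height
        \<open>exp (1 / \<epsilon>)\<close>.\<close>
      then have "emeasure M (C (\<lambda>_. \<bar>\<alpha>\<bar>)) = ennreal (exp (- (1 / \<epsilon>)))"
        using prod_h by (intro C_emeasure) auto
      then show ?thesis
        using equal
        by (simp add: abs_pow_minus_infinity_def ennreal_mult[symmetric] exp_add[symmetric])
    next
      case less
      have "ennreal (exp (- (1 / \<epsilon>)) / \<bar>\<alpha>\<bar> ^ N) \<le> emeasure M (C (\<lambda>_. \<bar>\<alpha>\<bar>))" for N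
      proof -
        \<comment> \<open>Only finitely many divisors differ from 1, so the volume is finite and the
          Baker condition applies; \<open>c i\<close> \<ge> |\<alpha>| puts the box inside the large
          one.\<close>
        define c where "c i = (if i < N then \<bar>\<alpha>\<bar> else 1)" for i
        have c: "c i > 0" "\<bar>\<alpha>\<bar> \<le> c i" for i
          using assms(2) less by (auto simp: c_def)
        have "(\<Prod>i<n. c i) = \<bar>\<alpha>\<bar> ^ N" if "n \<ge> N" for n
        proof -
          have "(\<Prod>i<n. c i) = (\<Prod>i<N. c i)"
            using that by (intro prod.mono_neutral_right) (auto simp: c_def)
          then show ?thesis by (simp add: c_def)
        qed
        then have "\<forall>\<^sub>F n in sequentially. (\<Prod>i<n. c i) = \<bar>\<alpha>\<bar> ^ N"
          by (auto simp: eventually_sequentially)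
        then have "(\<lambda>n. \<Prod>i<n. c i) \<longlonglongrightarrow> \<bar>\<alpha>\<bar> ^ N"
          by (rule tendsto_eventually)
        then have "emeasure M (C c) = ennreal (exp (- (1 / \<epsilon>)) / \<bar>\<alpha>\<bar> ^ N)"
          using assms(2) by (intro C_emeasure c tendsto_divide prod_h) auto
        moreover have "C c \<subseteq> C (\<lambda>_. \<bar>\<alpha>\<bar>)"
        proof -
          have "h i / c i \<le> h i / \<bar>\<alpha>\<bar>" for i
            using c[of i] h(1)[of i] assms(2) by (intro divide_left_mono) auto
          then show ?thesis
            unfolding C_def by (auto intro: order_trans) (meson neg_le_iff_le order_trans)
        qed
        ultimately show ?thesis
          using emeasure_mono[OF _ C_sets] by metis
      qed
      moreover have "(\<lambda>N. ennreal (exp (- (1 / \<epsilon>)) / \<bar>\<alpha>\<bar> ^ N)) \<longlonglongrightarrow> \<infinity>"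
      proof -
        have "filterlim (\<lambda>N. exp (- (1 / \<epsilon>)) * (1 / \<bar>\<alpha>\<bar>) ^ N) at_top sequentially"
          using less assms(2)
          by (intro filterlim_tendsto_pos_mult_at_top[OF tendsto_const]
              filterlim_at_infinity_imp_filterlim_at_top[OF filterlim_realpow_sequentially_gt1]) auto
        then show ?thesis
          by (simp add: power_divide ennreal_tendsto_top_eq_at_top)
      qed
      \<comment> \<open>The large box does not depend on \<open>N\<close>, so its measure bounds the
        limit of these volumes.\<close>
      ultimately have "\<infinity> \<le> emeasure M (C (\<lambda>_. \<bar>\<alpha>\<bar>))"
        by (intro tendsto_upperbound[where F = sequentially]) auto
      then show ?thesis
        using less by (simp add: abs_pow_minus_infinity_def top.extremum_unique ennreal_mult_top)
    qed
    finally show ?thesis .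
  qed
  then show ?thesis
    by (intro tendsto_eventually) (auto intro: eventually_mono[OF eventually_at_right_less])
qed

end
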